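(* Let $\overrightarrow{G}$ be a 2-qBMG. Then the underlying undirected graph of $\overrightarrow{G}$ is $P_6$-free, i.e. it has no induced subgraph isomorphic to the path graph $P_6$ on six vertices.
   Context: A two-color quasi best match graph (2-qBMG) is a bipartite directed graph $\overrightarrow{G}$ (vertex set split into two color classes, every edge joining vertices of different colors) without loops and parallel edges, satisfying: (N1) if $u$ and $v$ are two independent (non-adjacent) vertices then there exist no vertices $w,t$ such that $ut, vw, tw$ are edges; (N2) (bi-transitivity) if $uv, vw, wt$ are edges then $ut$ is an edge; (N3) if $u$ and $v$ have a common out-neighbor then either every out-neighbor of $u$ is an out-neighbor of $v$ or every out-neighbor of $v$ is an out-neighbor of $u$. The underlying undirected graph of a digraph has the same vertex set and an undirected edge $\{u,v\}$ whenever $uv$ or $vu$ is a directed edge. The path graph $P_n$ is the graph on vertices $v_1,\dots,v_n$ whose only edges are $v_iv_{i+1}$, $1\le i<n$. *)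

theory Defs
  imports "Graph_Theory.Graph_Theory"
begin

definition bipartite :: "('a, 'b) pre_digraph \<Rightarrow> bool" where
  "bipartite G \<longleftrightarrow> (\<exists>U V. verts G = U \<union> V \<and> U \<inter> V = {} \<and>
     arcs_ends G \<subseteq> U \<times> V \<union> V \<times> U)"

definition independent_verts :: "('a, 'b) pre_digraph \<Rightarrow> 'a \<Rightarrow> 'a \<Rightarrow> bool" where
  "independent_verts G u v \<longleftrightarrow> u \<in> verts G \<and> v \<in> verts G \<and> u \<noteq> v \<and>
     \<not> u \<rightarrow>\<^bsub>G\<^esub> v \<and> \<not> v \<rightarrow>\<^bsub>G\<^esub> u"

definition out_neighbors :: "('a, 'b) pre_digraph \<Rightarrow> 'a \<Rightarrow> 'a set" where
  "out_neighbors G u = {x. u \<rightarrow>\<^bsub>G\<^esub> x}"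

text \<open>Parallel arcs are distinct arcs with the same tail and the same head; a pair of opposite
  arcs between two vertices is allowed. The vertex set is not required to be finite.\<close>

locale two_qBMG = loopfree_digraph G + nomulti_digraph G
  for G :: "('a, 'b) pre_digraph" +
  assumes bipartite: "bipartite G"
    and N1: "independent_verts G u v \<Longrightarrow> \<not> (\<exists>w t. u \<rightarrow>\<^bsub>G\<^esub> t \<and> v \<rightarrow>\<^bsub>G\<^esub> w \<and> t \<rightarrow>\<^bsub>G\<^esub> w)"
    and N2: "u \<rightarrow>\<^bsub>G\<^esub> v \<Longrightarrow> v \<rightarrow>\<^bsub>G\<^esub> w \<Longrightarrow> w \<rightarrow>\<^bsub>G\<^esub> t \<Longrightarrow> u \<rightarrow>\<^bsub>G\<^esub> t"
    and N3: "out_neighbors G u \<inter> out_neighbors G v \<noteq> {} \<Longrightarrow>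
      out_neighbors G u \<subseteq> out_neighbors G v \<or> out_neighbors G v \<subseteq> out_neighbors G u"

text \<open>As in the library, undirected graphs are symmetric digraphs: an undirected edge is the pair
  of its two opposite arcs, and \<^const>\<open>mk_symmetric\<close> is the underlying undirected graph.\<close>

definition path_graph :: "nat \<Rightarrow> nat pair_pre_digraph" where
  "path_graph n = \<lparr> pverts = {1..n},
     parcs = (\<Union>i\<in>{1..<n}. {(i, Suc i), (Suc i, i)}) \<rparr>"

definition path_graph_free :: "nat \<Rightarrow> ('a, 'b) pre_digraph \<Rightarrow> bool" where
  "path_graph_free n G \<longleftrightarrow>
     \<not> (\<exists>H. induced_subgraph H G \<and> digraph_iso H (with_proj (path_graph n)))"

end

theory Submission
  imports Defs
begin

text \<open>Let \<open>x\<^sub>1 \<dots> x\<^sub>6\<close> be an induced path of the underlying graph. If \<open>abcd\<close> is an induced path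
  with \<open>a \<rightarrow> b \<rightarrow> c\<close>, then (N1) excludes \<open>d \<rightarrow> c\<close> and (N2) excludes \<open>c \<rightarrow> d\<close>. Applied along the path
  in both reading directions, this makes its second, third and fourth edges alternate in direction.
  The middle edge then has as its head a common out-neighbor of its tail and of the vertex beyond
  its head, and the same fact provides each of these two with a further out-neighbor on the path
  that is not adjacent to the other one. This contradicts (N3).\<close>

lemma induced_subgraph_arcs_ends_iff:
  assumes "induced_subgraph H G" "u \<in> verts H" "v \<in> verts H"
  shows "u \<rightarrow>\<^bsub>H\<^esub> v \<longleftrightarrow> u \<rightarrow>\<^bsub>G\<^esub> v"
  using assms
  by (auto simp: induced_subgraph_def subgraph_def compatible_def arcs_ends_conv)

text \<open>Inverting the isomorphism \<open>H\<close> to \<open>P\<close> lets the vertices of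
  \<open>P\<close> name vertices of \<open>G\<close>. Since \<open>H\<close> is induced,
  non-adjacency in \<open>P\<close> carries over to \<open>G\<close> as well as adjacency.\<close>

lemma digraph_iso_embedding:
  assumes "induced_subgraph H G" "digraph_iso H P"
  obtains f where "inj_on f (verts P)" "f ` verts P \<subseteq> verts G"
    "\<And>u v. u \<in> verts P \<Longrightarrow> v \<in> verts P \<Longrightarrow> f u \<rightarrow>\<^bsub>G\<^esub> f v \<longleftrightarrow> u \<rightarrow>\<^bsub>P\<^esub> v"
proof -
  have sub: "subgraph H G" using assms(1) by auto
  then interpret H: wf_digraph H by (simp add: subgraph_def)
  obtain h where h: "H.digraph_isomorphism h" and P: "P = app_iso h H"
    using assms(2) unfolding digraph_iso_def by blast
  define f where "f = the_inv_into (verts H) (iso_verts h)"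
  have inj: "inj_on (iso_verts h) (verts H)"
    using h by (rule H.digraph_isomorphism_inj_on_verts)
  have fV: "f ` verts P = verts H"
    using inj by (simp add: f_def P the_inv_into_onto)
  have ends: "arcs_ends P = (\<lambda>(u, v). (iso_verts h u, iso_verts h v)) ` arcs_ends H"
    unfolding P by (rule H.arcs_ends_app_iso_eq[OF h])
  show thesis
  proof
    show "inj_on f (verts P)"
      unfolding f_def P using inj by (simp add: inj_on_the_inv_into)
    show "f ` verts P \<subseteq> verts G" using fV sub by (auto simp: subgraph_def)
  next
    fix u v assume "u \<in> verts P" "v \<in> verts P"
    then obtain a b where ab: "a \<in> verts H" "b \<in> verts H" "u = iso_verts h a" "v = iso_verts h b"
      by (auto simp: P)
    then have f: "f u = a" "f v = b" by (simp_all add: f_def the_inv_into_f_f[OF inj])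
    \<comment> \<open>An arc of \<open>P\<close> is the image of some arc of \<open>H\<close>;
      injectivity on vertices forces the ends of that arc to be \<open>a\<close> and
      \<open>b\<close>.\<close>
    have "u \<rightarrow>\<^bsub>P\<^esub> v \<longleftrightarrow> a \<rightarrow>\<^bsub>H\<^esub> b"
      unfolding ends using ab inj
      by (auto dest!: inj_onD[OF inj] intro: H.adj_in_verts)
    then show "f u \<rightarrow>\<^bsub>G\<^esub> f v \<longleftrightarrow> u \<rightarrow>\<^bsub>P\<^esub> v"
      using ab f by (simp add: induced_subgraph_arcs_ends_iff[OF assms(1)])
  qed
qed

lemma parcs_mk_symmetric_iff:
  "(u, v) \<in> parcs (mk_symmetric G) \<longleftrightarrow> u \<rightarrow>\<^bsub>G\<^esub> v \<or> v \<rightarrow>\<^bsub>G\<^esub> u"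
  by (auto simp: parcs_mk_symmetric arcs_ends_conv)

lemma pverts_path_graph: "pverts (path_graph n) = {1..n}"
  by (simp add: path_graph_def)

lemma parcs_path_graph_iff:
  "(i, j) \<in> parcs (path_graph n) \<longleftrightarrow>
     i \<in> {1..n} \<and> j \<in> {1..n} \<and> (j = Suc i \<or> i = Suc j)"
  by (auto simp: path_graph_def)

context two_qBMG
begin

lemma no_directed_two_path:
  assumes "independent_verts G a d" "c \<rightarrow>\<^bsub>G\<^esub> d \<or> d \<rightarrow>\<^bsub>G\<^esub> c"
  shows "\<not> (a \<rightarrow>\<^bsub>G\<^esub> b \<and> b \<rightarrow>\<^bsub>G\<^esub> c)"
  using assms N1[of a d] N2[of a b c d] by (auto simp: independent_verts_def)

text \<open>The common out-neighbor \<open>w\<close> triggers (N3), while \<open>x\<close> and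
  \<open>y\<close> refute one inclusion each.\<close>

lemma no_crossing_out_neighbors:
  assumes "u \<rightarrow>\<^bsub>G\<^esub> w" "v \<rightarrow>\<^bsub>G\<^esub> w" "u \<rightarrow>\<^bsub>G\<^esub> x" "\<not> v \<rightarrow>\<^bsub>G\<^esub> x" "v \<rightarrow>\<^bsub>G\<^esub> y" "\<not> u \<rightarrow>\<^bsub>G\<^esub> y"
  shows False
  using N3[of u v] assms by (auto simp: out_neighbors_def)

end

theorem theorem3p1:
  fixes G :: "('a, 'b) pre_digraph"
  assumes "two_qBMG G"
  shows "path_graph_free 6 (with_proj (mk_symmetric G))"
proof -
  interpret two_qBMG G by fact
  show ?thesis
    unfolding path_graph_free_def
  proof (rule notI, elim exE conjE)
    fix H assume H: "induced_subgraph H (with_proj (mk_symmetric G))"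
      "digraph_iso H (with_proj (path_graph 6))"
    obtain f where inj: "inj_on f {1..6::nat}" and V: "f ` {1..6} \<subseteq> verts G"
      and ends: "\<And>i j. i \<in> {1..6} \<Longrightarrow> j \<in> {1..6} \<Longrightarrow>
        (f i \<rightarrow>\<^bsub>G\<^esub> f j \<or> f j \<rightarrow>\<^bsub>G\<^esub> f i) \<longleftrightarrow> (j = Suc i \<or> i = Suc j)"
      by (rule digraph_iso_embedding[OF H])
         (simp add: parcs_mk_symmetric_iff parcs_path_graph_iff pverts_path_graph)
    have edge: "f i \<rightarrow>\<^bsub>G\<^esub> f (Suc i) \<or> f (Suc i) \<rightarrow>\<^bsub>G\<^esub> f i" if "i \<in> {1..5}" for i
      using that ends[of i "Suc i"] by auto
    have indep: "independent_verts G (f i) (f j)"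
      if "i \<in> {1..6}" "j \<in> {1..6}" "i \<noteq> j" "j \<noteq> Suc i" "i \<noteq> Suc j" for i j
      using that ends[of i j] V inj by (auto simp: independent_verts_def inj_on_eq_iff)
    \<comment> \<open>Here \<open>f (i + 3)\<close> is the fourth vertex of the induced path, hence
      the bound 3 on \<open>i\<close>.\<close>
    have fwd: "\<not> (f i \<rightarrow>\<^bsub>G\<^esub> f (i + 1) \<and> f (i + 1) \<rightarrow>\<^bsub>G\<^esub> f (i + 2))" if "i \<in> {1..3}" for i
      using that edge[of "i + 2"]
      by (intro no_directed_two_path[of _ "f (i + 3)"] indep) (auto simp: eval_nat_numeral)
    \<comment> \<open>The same four vertices read from \<open>f (i + 3)\<close> down to
      \<open>f i\<close>, so the closing edge is now the one between \<open>f i\<close> and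
      \<open>f (i + 1)\<close>.\<close>
    have bwd: "\<not> (f (i + 3) \<rightarrow>\<^bsub>G\<^esub> f (i + 2) \<and> f (i + 2) \<rightarrow>\<^bsub>G\<^esub> f (i + 1))" if "i \<in> {1..3}" for i
      using that edge[of i] by (intro no_directed_two_path[of _ "f i"] indep) auto
    have edges: "f 1 \<rightarrow>\<^bsub>G\<^esub> f 2 \<or> f 2 \<rightarrow>\<^bsub>G\<^esub> f 1" "f 2 \<rightarrow>\<^bsub>G\<^esub> f 3 \<or> f 3 \<rightarrow>\<^bsub>G\<^esub> f 2" "f 3 \<rightarrow>\<^bsub>G\<^esub> f 4 \<or> f 4 \<rightarrow>\<^bsub>G\<^esub> f 3"
      "f 4 \<rightarrow>\<^bsub>G\<^esub> f 5 \<or> f 5 \<rightarrow>\<^bsub>G\<^esub> f 4" "f 5 \<rightarrow>\<^bsub>G\<^esub> f 6 \<or> f 6 \<rightarrow>\<^bsub>G\<^esub> f 5"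
      using edge[of 1] edge[of 2] edge[of 3] edge[of 4] edge[of 5]
      by (simp_all add: eval_nat_numeral)
    have non_edges: "\<not> f 4 \<rightarrow>\<^bsub>G\<^esub> f 1" "\<not> f 2 \<rightarrow>\<^bsub>G\<^esub> f 5" "\<not> f 5 \<rightarrow>\<^bsub>G\<^esub> f 2" "\<not> f 3 \<rightarrow>\<^bsub>G\<^esub> f 6"
      using ends[of 1 4] ends[of 2 5] ends[of 3 6] by auto
    have no_paths: "\<not> (f 1 \<rightarrow>\<^bsub>G\<^esub> f 2 \<and> f 2 \<rightarrow>\<^bsub>G\<^esub> f 3)" "\<not> (f 2 \<rightarrow>\<^bsub>G\<^esub> f 3 \<and> f 3 \<rightarrow>\<^bsub>G\<^esub> f 4)"
      "\<not> (f 3 \<rightarrow>\<^bsub>G\<^esub> f 4 \<and> f 4 \<rightarrow>\<^bsub>G\<^esub> f 5)" "\<not> (f 4 \<rightarrow>\<^bsub>G\<^esub> f 3 \<and> f 3 \<rightarrow>\<^bsub>G\<^esub> f 2)"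
      "\<not> (f 5 \<rightarrow>\<^bsub>G\<^esub> f 4 \<and> f 4 \<rightarrow>\<^bsub>G\<^esub> f 3)" "\<not> (f 6 \<rightarrow>\<^bsub>G\<^esub> f 5 \<and> f 5 \<rightarrow>\<^bsub>G\<^esub> f 4)"
      using fwd[of 1] fwd[of 2] fwd[of 3] bwd[of 1] bwd[of 2] bwd[of 3]
      by (simp_all add: eval_nat_numeral)
    show False
    proof (cases "f 4 \<rightarrow>\<^bsub>G\<^esub> f 3")
      case True
      \<comment> \<open>The common out-neighbor is \<open>f 3\<close>, of \<open>f 2\<close> and
        \<open>f 4\<close>; their private out-neighbors are \<open>f 1\<close> and
        \<open>f 5\<close>.\<close>
      then have "f 2 \<rightarrow>\<^bsub>G\<^esub> f 3" "f 4 \<rightarrow>\<^bsub>G\<^esub> f 5" "f 2 \<rightarrow>\<^bsub>G\<^esub> f 1"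
        using edges no_paths by auto
      then show False using True non_edges no_crossing_out_neighbors by blast
    next
      case False
      \<comment> \<open>Mirror image of the first case under \<open>i\<close> to
        \<open>7 - i\<close>: \<open>f 3\<close> and \<open>f 5\<close> share \<open>f 4\<close>,
        with private out-neighbors \<open>f 2\<close> and \<open>f 6\<close>.\<close>
      then have "f 3 \<rightarrow>\<^bsub>G\<^esub> f 4" "f 3 \<rightarrow>\<^bsub>G\<^esub> f 2" "f 5 \<rightarrow>\<^bsub>G\<^esub> f 4" "f 5 \<rightarrow>\<^bsub>G\<^esub> f 6"
        using edges no_paths by auto
      then show False using non_edges no_crossing_out_neighbors by blast
    qed
  qed
qed

end
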